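(* Let $(X,\lVert\cdot\rVert_X)$ be a quasi-Banach function space over $(R,\mu)$ and let $\lVert\cdot\rVert_{X'}$ and $X'$ be the corresponding associate functional and associate space, respectively. Then an arbitrary function $f\in M$ belongs to $X'$ if and only if $$\int_R|fg|\,d\mu<\infty$$ for all $g\in X$.
   Context: $(R,\mu)$ is a $\sigma$-finite measure space. $M=M(R,\mu)$ is the set of all $\mu$-measurable functions $R\to\mathbb C\cup\{\infty\}$, functions equal $\mu$-a.e. being identified; $M_+$ is the subset of functions with values in $[0,\infty]$. A quasi-Banach function norm is a map $\lVert\cdot\rVert:M\to[0,\infty]$ with $\lVert\,|f|\,\rVert=\lVert f\rVert$ for all $f\in M$ whose restriction to $M_+$ satisfies: (Q1) (a) $\lVert af\rVert=|a|\lVert f\rVert$ for all $a\in\mathbb C$, $f\in M_+$ (with the usual convention $0\cdot\infty=0$); (b) $\lVert f\rVert=0$ iff $f=0$ $\mu$-a.e.; (c) there is a constant $C\ge1$ (the modulus of concavity) such that $\lVert f+g\rVert\le C(\lVert f\rVert+\lVert g\rVert)$ for all $f,g\in M_+$; (P2) if $f,g\in M_+$ and $f\le g$ $\mu$-a.e., then $\lVert f\rVert\le\lVert g\rVert$; (P3) if $f_n,f\in M_+$ and $f_n\uparrow f$ $\mu$-a.e., then $\lVert f_n\rVert\uparrow\lVert f\rVert$; (P4) $\lVert\chi_E\rVert<\infty$ for every measurable $E\subseteq R$ with $\mu(E)<\infty$. The corresponding quasi-Banach function space is $X=\{f\in M:\lVert f\rVert_X<\infty\}$ with the quasinorm $\lVert\cdot\rVert_X$.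 The associate functional is defined for $f\in M$ by $$\lVert f\rVert_{X'}=\sup_{g\in X}\frac1{\lVert g\rVert_X}\int_R|fg|\,d\mu,$$ where $\frac00=0$ and $\frac a0=\infty$ for $a>0$, and the associate space is $X'=\{f\in M:\lVert f\rVert_{X'}<\infty\}$. *)

theory Defs
  imports "HOL-Analysis.Analysis"
begin

datatype xcomplex = Fin complex | Infty

instantiation xcomplex :: "{zero, times}"
begin

definition zero_xcomplex :: xcomplex where
  "0 = Fin 0"

text \<open>The convention \<open>0 \<cdot> \<infinity> = 0\<close> is the one used by \<^typ>\<open>ennreal\<close>.\<close>

fun times_xcomplex :: "xcomplex \<Rightarrow> xcomplex \<Rightarrow> xcomplex" where
  "Fin a * Fin b = Fin (a * b)"
| "Fin a * Infty = (if a = 0 then 0 else Infty)"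
| "Infty * Fin b = (if b = 0 then 0 else Infty)"
| "Infty * Infty = Infty"

instance ..

end

fun modulus :: "xcomplex \<Rightarrow> ennreal" where
  "modulus (Fin z) = ennreal (cmod z)"
| "modulus Infty = \<infinity>"

text \<open>The inclusion of \<open>[0, \<infinity>]\<close> into the extended complex numbers.\<close>

definition of_ennreal :: "ennreal \<Rightarrow> xcomplex" where
  "of_ennreal r = (if r = \<infinity> then Infty else Fin (complex_of_real (enn2real r)))"

text \<open>A set is measurable iff its finite part is Borel in \<open>\<complex>\<close>; these are the Borel sets of the
  one-point compactification. The family below is already a \<open>\<sigma>\<close>-algebra (\<open>sets_xborel\<close>).\<close>

definition xborel :: "xcomplex measure" where
  "xborel = sigma UNIV {A. Fin -` A \<in> sets borel}"

lemma space_xborel [simp]: "space xborel = UNIV"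
  by (simp add: xborel_def)

lemma sets_xborel: "sets xborel = {A. Fin -` A \<in> sets borel}"
proof -
  have "sigma_algebra UNIV {A. Fin -` A \<in> sets (borel :: complex measure)}"
    unfolding sigma_algebra_iff2
  proof (intro conjI ballI allI impI)
    fix A :: "xcomplex set"
    assume "A \<in> {A. Fin -` A \<in> sets borel}"
    then show "UNIV - A \<in> {A. Fin -` A \<in> sets borel}"
      by (simp add: vimage_Compl borel_comp flip: Compl_eq_Diff_UNIV)
  qed (auto simp: vimage_Union)
  then show ?thesis
    unfolding xborel_def by (simp add: sigma_algebra.sigma_sets_eq)
qed

lemma measurable_modulus [measurable]: "modulus \<in> xborel \<rightarrow>\<^sub>M borel"
proof (rule measurableI)
  fix A :: "ennreal set"
  assume "A \<in> sets borel"
  then have "(\<lambda>z. ennreal (cmod z)) -` A \<inter> space borel \<in> sets borel"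
    by (intro measurable_sets) auto
  moreover have "Fin -` modulus -` A = (\<lambda>z. ennreal (cmod z)) -` A"
    by auto
  ultimately show "modulus -` A \<inter> space xborel \<in> sets xborel"
    by (simp add: sets_xborel)
qed simp

lemma measurable_of_ennreal [measurable]: "of_ennreal \<in> borel \<rightarrow>\<^sub>M xborel"
proof (rule measurableI)
  fix A
  assume "A \<in> sets xborel"
  then have A [measurable]: "Fin -` A \<in> sets borel"
    by (simp add: sets_xborel)
  have "of_ennreal -` A \<inter> space borel =
      {r. (r = \<infinity> \<and> Infty \<in> A) \<or> (r \<noteq> \<infinity> \<and> complex_of_real (enn2real r) \<in> Fin -` A)}"
    by (auto simp: of_ennreal_def split: if_splits)
  also have "\<dots> \<in> sets borel"
    by measurable
  finally show "of_ennreal -` A \<inter> space borel \<in> sets borel" .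
qed simp

lemma modulus_mult: "modulus (a * b) = modulus a * modulus b"
  by (cases a; cases b)
     (auto simp: norm_mult ennreal_mult ennreal_mult_top ennreal_top_mult zero_xcomplex_def)

lemma modulus_of_ennreal [simp]: "modulus (of_ennreal r) = r"
  by (auto simp: of_ennreal_def less_top)


text \<open>Elements of \<open>M\<close> are represented by functions; the identification of functions equal almost
  everywhere is expressed by requiring functionals on \<open>M\<close> to respect almost everywhere
  equality. \<open>M\<^sub>+\<close> is represented by the \<^typ>\<open>ennreal\<close>-valued Borel measurable functions
  (see \<open>Mplus_eq\<close>), which enter \<open>M\<close> through \<open>lift\<close>.\<close>

abbreviation meas_fun :: "'a measure \<Rightarrow> ('a \<Rightarrow> xcomplex) set" where
  "meas_fun \<mu> \<equiv> measurable \<mu> xborel"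

abbreviation lift :: "('a \<Rightarrow> ennreal) \<Rightarrow> 'a \<Rightarrow> xcomplex" where
  "lift f \<equiv> (\<lambda>x. of_ennreal (f x))"

lemma Mplus_eq:
  "lift ` borel_measurable \<mu> = {f \<in> meas_fun \<mu>. \<forall>x. f x \<in> range of_ennreal}"
proof (intro equalityI subsetI)
  fix f
  assume f: "f \<in> {f \<in> meas_fun \<mu>. \<forall>x. f x \<in> range of_ennreal}"
  then have "f x = of_ennreal (modulus (f x))" for x
    using modulus_of_ennreal by (metis (mono_tags, lifting) imageE mem_Collect_eq)
  moreover have "(\<lambda>x. modulus (f x)) \<in> borel_measurable \<mu>"
    using f by (auto intro: measurable_compose)
  ultimately show "f \<in> lift ` borel_measurable \<mu>"
    by (metis (no_types, lifting) ext imageI)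
qed auto


definition quasi_Banach_function_norm ::
  "'a measure \<Rightarrow> (('a \<Rightarrow> xcomplex) \<Rightarrow> ennreal) \<Rightarrow> bool" where
  "quasi_Banach_function_norm \<mu> N \<longleftrightarrow>
     \<comment> \<open>well defined on classes modulo a.e. equality\<close>
     (\<forall>f\<in>meas_fun \<mu>. \<forall>g\<in>meas_fun \<mu>. (AE x in \<mu>. f x = g x) \<longrightarrow> N f = N g) \<and>
     (\<forall>f\<in>meas_fun \<mu>. N (lift (\<lambda>x. modulus (f x))) = N f) \<and>
     (\<forall>a. \<forall>f\<in>borel_measurable \<mu>.
        N (\<lambda>x. Fin a * lift f x) = ennreal (cmod a) * N (lift f)) \<and>
     (\<forall>f\<in>borel_measurable \<mu>. N (lift f) = 0 \<longleftrightarrow> (AE x in \<mu>. f x = 0)) \<and>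
     (\<exists>C::real. C \<ge> 1 \<and> (\<forall>f\<in>borel_measurable \<mu>. \<forall>g\<in>borel_measurable \<mu>.
        N (lift (\<lambda>x. f x + g x)) \<le> ennreal C * (N (lift f) + N (lift g)))) \<and>
     (\<forall>f\<in>borel_measurable \<mu>. \<forall>g\<in>borel_measurable \<mu>.
        (AE x in \<mu>. f x \<le> g x) \<longrightarrow> N (lift f) \<le> N (lift g)) \<and>
     (\<forall>F. \<forall>f\<in>borel_measurable \<mu>. (\<forall>n::nat. F n \<in> borel_measurable \<mu>) \<longrightarrow>
        (AE x in \<mu>. incseq (\<lambda>n. F n x) \<and> (\<lambda>n. F n x) \<longlonglongrightarrow> f x) \<longrightarrow>
        incseq (\<lambda>n. N (lift (F n))) \<and> (\<lambda>n. N (lift (F n))) \<longlonglongrightarrow> N (lift f)) \<and>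
     (\<forall>E\<in>sets \<mu>. emeasure \<mu> E < \<infinity> \<longrightarrow> N (lift (indicator E)) < \<infinity>)"

definition function_space ::
  "'a measure \<Rightarrow> (('a \<Rightarrow> xcomplex) \<Rightarrow> ennreal) \<Rightarrow> ('a \<Rightarrow> xcomplex) set" where
  "function_space \<mu> N = {f \<in> meas_fun \<mu>. N f < \<infinity>}"

text \<open>Division in \<^typ>\<open>ennreal\<close> satisfies \<open>0 / 0 = 0\<close> and \<open>a / 0 = \<infinity>\<close> for \<open>a > 0\<close>.\<close>

definition associate_functional ::
  "'a measure \<Rightarrow> (('a \<Rightarrow> xcomplex) \<Rightarrow> ennreal) \<Rightarrow> ('a \<Rightarrow> xcomplex) \<Rightarrow> ennreal" where
  "associate_functional \<mu> N f =
     (SUP g\<in>function_space \<mu> N. (\<integral>\<^sup>+x. modulus (f x * g x) \<partial>\<mu>) / N g)"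

definition associate_space ::
  "'a measure \<Rightarrow> (('a \<Rightarrow> xcomplex) \<Rightarrow> ennreal) \<Rightarrow> ('a \<Rightarrow> xcomplex) set" where
  "associate_space \<mu> N = {f \<in> meas_fun \<mu>. associate_functional \<mu> N f < \<infinity>}"

lemma ennreal_zero_div_zero: "(0::ennreal) / 0 = 0"
  by simp

lemma ennreal_pos_div_zero: "a > 0 \<Longrightarrow> a / 0 = (\<infinity>::ennreal)"
  by (simp add: ennreal_divide_zero)

end

theory Submission imports Defs begin

text \<open>Only the implication from pointwise finiteness to \<open>f \<in> X'\<close> needs an idea. If the supremum
  is infinite, there are \<open>u\<^sub>n \<ge> 0\<close> with \<open>\<parallel>u\<^sub>n\<parallel> = (2C)\<^sup>-\<^sup>n\<close> and \<open>\<integral> |f| u\<^sub>n \<ge> 1\<close>. Iterating the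
  quasi-triangle inequality and passing to the limit by the Fatou property (P3) gives
  \<open>\<parallel>\<Sum>n. u\<^sub>n\<parallel> \<le> \<Sum>n. C\<^sup>n\<^sup>+\<^sup>1 \<parallel>u\<^sub>n\<parallel> = 2C\<close>, so \<open>\<Sum>n. u\<^sub>n\<close> lies in \<open>X\<close> although its product with \<open>f\<close> is
  not integrable.\<close>

text \<open>Turns complex scalars, in which homogeneity is stated, into \<open>ennreal\<close>
  factors. At \<open>r = \<infinity>\<close> and \<open>a = 0\<close> both products vanish by the
  convention 0 times infinity is 0.\<close>

lemma Fin_mult_of_ennreal:
  assumes "0 \<le> a"
  shows "Fin (complex_of_real a) * of_ennreal r = of_ennreal (ennreal a * r)"
proof (cases "r = \<infinity>")
  case True
  with assms show ?thesis
    by (auto simp: of_ennreal_def zero_xcomplex_def ennreal_mult_top)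
next
  case False
  then obtain s where "0 \<le> s" "r = ennreal s"
    by (cases r) auto
  with assms show ?thesis
    by (simp add: of_ennreal_def flip: ennreal_mult)
qed

text \<open>This and the next four lemmas isolate the axioms that the argument uses, one at a
  time.\<close>

lemma quasi_Banach_function_norm_modulus:
  assumes "quasi_Banach_function_norm \<mu> N" "f \<in> meas_fun \<mu>"
  shows "N (lift (\<lambda>x. modulus (f x))) = N f"
proof -
  have "\<forall>f\<in>meas_fun \<mu>. N (lift (\<lambda>x. modulus (f x))) = N f"
    using assms(1) unfolding quasi_Banach_function_norm_def by (elim conjE)
  then show ?thesis
    using assms(2) by (rule bspec)
qed

lemma quasi_Banach_function_norm_scale:
  assumes "quasi_Banach_function_norm \<mu> N" "u \<in> borel_measurable \<mu>" "0 \<le> a"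
  shows "N (lift (\<lambda>x. ennreal a * u x)) = ennreal a * N (lift u)"
proof -
  have "\<forall>a. \<forall>f\<in>borel_measurable \<mu>. N (\<lambda>x. Fin a * lift f x) = ennreal (cmod a) * N (lift f)"
    using assms(1) unfolding quasi_Banach_function_norm_def by (elim conjE)
  then have "N (\<lambda>x. Fin (complex_of_real a) * lift u x) =
      ennreal (cmod (complex_of_real a)) * N (lift u)"
    by (rule allE) (erule bspec [OF _ assms(2)])
  with assms(3) show ?thesis
    by (simp add: Fin_mult_of_ennreal)
qed

lemma quasi_Banach_function_norm_eq_0_iff:
  assumes "quasi_Banach_function_norm \<mu> N" "u \<in> borel_measurable \<mu>"
  shows "N (lift u) = 0 \<longleftrightarrow> (AE x in \<mu>. u x = 0)"
proof -
  have "\<forall>f\<in>borel_measurable \<mu>. N (lift f) = 0 \<longleftrightarrow> (AE x in \<mu>. f x = 0)"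
    using assms(1) unfolding quasi_Banach_function_norm_def by (elim conjE)
  then show ?thesis
    using assms(2) by (rule bspec)
qed

lemma quasi_Banach_function_norm_triangle:
  assumes "quasi_Banach_function_norm \<mu> N"
  obtains C :: real where "1 \<le> C"
    "\<forall>u\<in>borel_measurable \<mu>. \<forall>v\<in>borel_measurable \<mu>.
       N (lift (\<lambda>x. u x + v x)) \<le> ennreal C * (N (lift u) + N (lift v))"
proof -
  have "\<exists>C::real. C \<ge> 1 \<and> (\<forall>u\<in>borel_measurable \<mu>. \<forall>v\<in>borel_measurable \<mu>.
      N (lift (\<lambda>x. u x + v x)) \<le> ennreal C * (N (lift u) + N (lift v)))"
    using assms unfolding quasi_Banach_function_norm_def by (elim conjE)
  then show thesis
    by (elim exE conjE) (rule that)
qed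

lemma quasi_Banach_function_norm_Fatou:
  assumes "quasi_Banach_function_norm \<mu> N" "\<And>n. F n \<in> borel_measurable \<mu>"
    "u \<in> borel_measurable \<mu>" "AE x in \<mu>. incseq (\<lambda>n. F n x) \<and> (\<lambda>n. F n x) \<longlonglongrightarrow> u x"
  shows "(\<lambda>n. N (lift (F n))) \<longlonglongrightarrow> N (lift u)"
proof -
  have "\<forall>F. \<forall>f\<in>borel_measurable \<mu>. (\<forall>n::nat. F n \<in> borel_measurable \<mu>) \<longrightarrow>
      (AE x in \<mu>. incseq (\<lambda>n. F n x) \<and> (\<lambda>n. F n x) \<longlonglongrightarrow> f x) \<longrightarrow>
      incseq (\<lambda>n. N (lift (F n))) \<and> (\<lambda>n. N (lift (F n))) \<longlonglongrightarrow> N (lift f)"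
    using assms(1) unfolding quasi_Banach_function_norm_def by (elim conjE)
  from this[rule_format, OF assms(3,2,4)] show ?thesis ..
qed

text \<open>Splitting off the first summand costs one factor \<open>C\<close> and leaves the shifted
  family, to which the induction hypothesis applies; hence \<open>u\<close> is arbitrary. The weight
  of the i-th term then depends on i alone and not on \<open>n\<close>, so the bound survives the
  limit.\<close>

lemma quasi_Banach_function_norm_sum_le:
  assumes N: "quasi_Banach_function_norm \<mu> N"
    and C: "\<forall>u\<in>borel_measurable \<mu>. \<forall>v\<in>borel_measurable \<mu>.
       N (lift (\<lambda>x. u x + v x)) \<le> ennreal C * (N (lift u) + N (lift v))"
    and "\<And>i. u i \<in> borel_measurable \<mu>"
  shows "N (lift (\<lambda>x. \<Sum>i<n. u i x)) \<le> (\<Sum>i<n. ennreal C ^ Suc i * N (lift (u i)))"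
  using assms(3)
proof (induction n arbitrary: u)
  case 0
  then show ?case
    \<comment> \<open>The empty sum is the zero function, whose quasinorm is 0.\<close>
    using quasi_Banach_function_norm_eq_0_iff[OF N, of "\<lambda>_. 0"] by simp
next
  case (Suc n)
  note [measurable] = Suc.prems
  have "N (lift (\<lambda>x. \<Sum>i<Suc n. u i x)) = N (lift (\<lambda>x. u 0 x + (\<Sum>i<n. u (Suc i) x)))"
    by (simp only: sum.lessThan_Suc_shift)
  also have "\<dots> \<le> ennreal C * (N (lift (u 0)) + N (lift (\<lambda>x. \<Sum>i<n. u (Suc i) x)))"
    by (intro C[rule_format]) measurable
  also have "\<dots> \<le> ennreal C *
      (N (lift (u 0)) + (\<Sum>i<n. ennreal C ^ Suc i * N (lift (u (Suc i)))))"
    by (intro mult_left_mono add_left_mono Suc.IH) auto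
  also have "\<dots> = (\<Sum>i<Suc n. ennreal C ^ Suc i * N (lift (u i)))"
    by (simp only: sum.lessThan_Suc_shift) (simp add: distrib_left sum_distrib_left mult.assoc)
  finally show ?case .
qed

text \<open>The partial sums of nonnegative functions increase pointwise to the series, so the Fatou
  property carries the finite estimate to the limit.\<close>

lemma quasi_Banach_function_norm_suminf_le:
  assumes N: "quasi_Banach_function_norm \<mu> N"
    and C: "\<forall>u\<in>borel_measurable \<mu>. \<forall>v\<in>borel_measurable \<mu>.
       N (lift (\<lambda>x. u x + v x)) \<le> ennreal C * (N (lift u) + N (lift v))"
    and [measurable]: "\<And>i. u i \<in> borel_measurable \<mu>"
  shows "N (lift (\<lambda>x. \<Sum>i. u i x)) \<le> (\<Sum>i. ennreal C ^ Suc i * N (lift (u i)))"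
proof (rule LIMSEQ_le)
  show "(\<lambda>n. N (lift (\<lambda>x. \<Sum>i<n. u i x))) \<longlonglongrightarrow> N (lift (\<lambda>x. \<Sum>i. u i x))"
    by (intro quasi_Banach_function_norm_Fatou[OF N])
       (auto intro!: incseq_SucI summable_LIMSEQ)
  show "(\<lambda>n. \<Sum>i<n. ennreal C ^ Suc i * N (lift (u i)))
      \<longlonglongrightarrow> (\<Sum>i. ennreal C ^ Suc i * N (lift (u i)))"
    by (intro summable_LIMSEQ) auto
  show "\<exists>n0. \<forall>n\<ge>n0. N (lift (\<lambda>x. \<Sum>i<n. u i x)) \<le> (\<Sum>i<n. ennreal C ^ Suc i * N (lift (u i)))"
    by (intro exI allI impI quasi_Banach_function_norm_sum_le[OF N C]) measurable
qed

text \<open>A vanishing quasinorm forces g = 0 a.e., and the product is then 0 even where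
  \<open>f\<close> is infinite. Such g contribute only 0/0 = 0 to the supremum.\<close>

lemma nn_integral_mult_eq_0_if_norm_eq_0:
  assumes N: "quasi_Banach_function_norm \<mu> N" and g: "g \<in> meas_fun \<mu>" "N g = 0"
  shows "(\<integral>\<^sup>+x. modulus (f x * g x) \<partial>\<mu>) = 0"
proof -
  have "AE x in \<mu>. modulus (g x) = 0"
    using quasi_Banach_function_norm_eq_0_iff[OF N, of "\<lambda>x. modulus (g x)"]
      quasi_Banach_function_norm_modulus[OF N g(1)] g
    by (auto intro: measurable_compose)
  then have "AE x in \<mu>. modulus (f x * g x) = 0"
    by eventually_elim (simp add: modulus_mult)
  then have "(\<integral>\<^sup>+x. modulus (f x * g x) \<partial>\<mu>) = (\<integral>\<^sup>+x. 0 \<partial>\<mu>)"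
    by (intro nn_integral_cong_AE)
  then show ?thesis
    by simp
qed

text \<open>The quotient in the supremum does not change when g is scaled by a positive real. A g
  with quotient above 1/t, rescaled to quasinorm t, therefore has integral at least t * (1/t) =
  1.\<close>

lemma associate_functional_infinite_imp:
  assumes N: "quasi_Banach_function_norm \<mu> N" and f: "f \<in> meas_fun \<mu>"
    and inf: "associate_functional \<mu> N f = \<infinity>" and t: "0 < t"
  obtains u where "u \<in> borel_measurable \<mu>" "N (lift u) = ennreal t"
    "1 \<le> (\<integral>\<^sup>+x. modulus (f x) * u x \<partial>\<mu>)"
proof -
  have "ennreal (1 / t) < associate_functional \<mu> N f"
    by (simp add: inf)
  then obtain g where g: "g \<in> function_space \<mu> N"
    and less: "ennreal (1 / t) < (\<integral>\<^sup>+x. modulus (f x * g x) \<partial>\<mu>) / N g"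
    unfolding associate_functional_def less_SUP_iff by blast
  have g_meas: "g \<in> meas_fun \<mu>" and "N g < \<infinity>"
    using g by (auto simp: function_space_def)
  \<comment> \<open>Otherwise the quotient would be 0/0 = 0, which does not exceed 1/t.\<close>
  have "N g \<noteq> 0"
    using less nn_integral_mult_eq_0_if_norm_eq_0[OF N g_meas] by auto
  with \<open>N g < \<infinity>\<close> obtain b where b: "0 < b" "N g = ennreal b"
    by (cases "N g") (auto simp: zero_less_iff_neq_zero)
  note [measurable] = f g_meas
  \<comment> \<open>With \<open>b = N g\<close>, the factor t/b normalises |g| to quasinorm
    t.\<close>
  define u where "u = (\<lambda>x. ennreal (t / b) * modulus (g x))"
  show ?thesis
  proof
    show "u \<in> borel_measurable \<mu>"
      unfolding u_def by measurable
    have "N (lift u) = ennreal (t / b) * N (lift (\<lambda>x. modulus (g x)))"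
      unfolding u_def using t b by (intro quasi_Banach_function_norm_scale[OF N]) auto
    also have "\<dots> = ennreal t"
      using t b by (simp add: quasi_Banach_function_norm_modulus[OF N g_meas] flip: ennreal_mult)
    finally show "N (lift u) = ennreal t" .
    have "1 = ennreal t * ennreal (1 / t)"
      using t by (simp flip: ennreal_mult)
    also have "\<dots> \<le> ennreal t * ((\<integral>\<^sup>+x. modulus (f x * g x) \<partial>\<mu>) / N g)"
      using less by (intro mult_left_mono) auto
    also have "\<dots> = ennreal (t / b) * (\<integral>\<^sup>+x. modulus (f x * g x) \<partial>\<mu>)"
      using t b by (simp add: divide_ennreal_def mult_ac flip: divide_ennreal)
    also have "\<dots> = (\<integral>\<^sup>+x. ennreal (t / b) * (modulus (f x) * modulus (g x)) \<partial>\<mu>)"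
      by (simp add: modulus_mult nn_integral_cmult)
    also have "\<dots> = (\<integral>\<^sup>+x. modulus (f x) * u x \<partial>\<mu>)"
      by (simp add: u_def mult.left_commute)
    finally show "1 \<le> (\<integral>\<^sup>+x. modulus (f x) * u x \<partial>\<mu>)" .
  qed
qed

lemma associate_functional_finite:
  assumes N: "quasi_Banach_function_norm \<mu> N" and f [measurable]: "f \<in> meas_fun \<mu>"
    and fin: "\<And>g. g \<in> function_space \<mu> N \<Longrightarrow> (\<integral>\<^sup>+x. modulus (f x * g x) \<partial>\<mu>) < \<infinity>"
  shows "associate_functional \<mu> N f < \<infinity>"
proof (rule ccontr)
  assume "\<not> ?thesis"
  then have inf: "associate_functional \<mu> N f = \<infinity>"
    by (simp flip: less_top)
  obtain C :: real where "1 \<le> C" and C: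
    "\<forall>u\<in>borel_measurable \<mu>. \<forall>v\<in>borel_measurable \<mu>.
       N (lift (\<lambda>x. u x + v x)) \<le> ennreal C * (N (lift u) + N (lift v))"
    using quasi_Banach_function_norm_triangle[OF N] by blast
  have "\<exists>u. u \<in> borel_measurable \<mu> \<and> N (lift u) = ennreal ((1 / (2 * C)) ^ n) \<and>
      1 \<le> (\<integral>\<^sup>+x. modulus (f x) * u x \<partial>\<mu>)" for n
    using associate_functional_infinite_imp[OF N f inf, of "(1 / (2 * C)) ^ n"] \<open>1 \<le> C\<close> by auto
  then obtain u where u [measurable]: "\<And>n. u n \<in> borel_measurable \<mu>"
    and Nu: "\<And>n. N (lift (u n)) = ennreal ((1 / (2 * C)) ^ n)"
    and int_u: "\<And>n. 1 \<le> (\<integral>\<^sup>+x. modulus (f x) * u n x \<partial>\<mu>)"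
    by metis
  define g where "g = lift (\<lambda>x. \<Sum>n. u n x)"
  have g: "g \<in> meas_fun \<mu>"
    unfolding g_def by measurable
  have "N g \<le> (\<Sum>n. ennreal C ^ Suc n * N (lift (u n)))"
    unfolding g_def by (intro quasi_Banach_function_norm_suminf_le[OF N C]) measurable
  \<comment> \<open>The powers of \<open>C\<close> cancel except for the one extra factor from
    \<open>Suc n\<close>, leaving a convergent geometric series.\<close>
  also have "\<dots> = (\<Sum>n. ennreal (C * (1 / 2) ^ n))"
  proof (rule suminf_cong)
    fix n
    have "ennreal C ^ Suc n * N (lift (u n)) = ennreal (C ^ Suc n * (1 / (2 * C)) ^ n)"
      using \<open>1 \<le> C\<close> by (simp only: Nu ennreal_power ennreal_mult zero_le_power
          zero_le_divide_1_iff order_trans[OF zero_le_one] mult_nonneg_nonneg zero_le_numeral)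
    also have "C ^ Suc n * (1 / (2 * C)) ^ n = C * (C * (1 / (2 * C))) ^ n"
      by (simp only: power_mult_distrib power_Suc mult.assoc)
    also have "\<dots> = C * (1 / 2) ^ n"
      using \<open>1 \<le> C\<close> by simp
    finally show "ennreal C ^ Suc n * N (lift (u n)) = ennreal (C * (1 / 2) ^ n)" .
  qed
  also have "\<dots> < \<infinity>"
    using \<open>1 \<le> C\<close> by (subst suminf_ennreal2) (auto intro!: summable_mult summable_geometric)
  finally have "g \<in> function_space \<mu> N"
    using g by (simp add: function_space_def)
  then have "(\<integral>\<^sup>+x. modulus (f x * g x) \<partial>\<mu>) < \<infinity>"
    by (rule fin)
  \<comment> \<open>All terms are nonnegative, so monotone convergence allows summing outside the
    integral, also where \<open>f\<close> is infinite.\<close>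
  also have "(\<integral>\<^sup>+x. modulus (f x * g x) \<partial>\<mu>) = (\<Sum>n. \<integral>\<^sup>+x. modulus (f x) * u n x \<partial>\<mu>)"
    by (simp add: g_def modulus_mult nn_integral_suminf flip: ennreal_suminf_cmult)
  finally have "(\<Sum>n. \<integral>\<^sup>+x. modulus (f x) * u n x \<partial>\<mu>) < \<infinity>" .
  moreover have "(\<Sum>n. 1) \<le> (\<Sum>n. \<integral>\<^sup>+x. modulus (f x) * u n x \<partial>\<mu>)"
    by (intro suminf_le int_u) auto
  \<comment> \<open>A sum of ones is the integral of 1 against counting measure on the
    naturals.\<close>
  moreover have "(\<Sum>n::nat. 1::ennreal) = \<infinity>"
    using nn_integral_count_space_nat[of "\<lambda>_. 1"] by simp
  ultimately show False
    by (simp add: top_unique)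
qed

theorem theorem3p11:
  fixes \<mu> :: "'a measure"
    and N :: "('a \<Rightarrow> xcomplex) \<Rightarrow> ennreal"
    and f :: "'a \<Rightarrow> xcomplex"
  assumes "sigma_finite_measure \<mu>"
    and "quasi_Banach_function_norm \<mu> N"
    and "f \<in> meas_fun \<mu>"
  shows "f \<in> associate_space \<mu> N \<longleftrightarrow>
    (\<forall>g\<in>function_space \<mu> N. (\<integral>\<^sup>+x. modulus (f x * g x) \<partial>\<mu>) < \<infinity>)"
proof
  assume f: "f \<in> associate_space \<mu> N"
  show "\<forall>g\<in>function_space \<mu> N. (\<integral>\<^sup>+x. modulus (f x * g x) \<partial>\<mu>) < \<infinity>"
  proof
    fix g
    assume g: "g \<in> function_space \<mu> N"
    let ?I = "\<integral>\<^sup>+x. modulus (f x * g x) \<partial>\<mu>"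
    \<comment> \<open>A single quotient is bounded by the supremum.\<close>
    have "?I / N g \<le> associate_functional \<mu> N f"
      unfolding associate_functional_def using g by (rule SUP_upper)
    also have "\<dots> < \<infinity>"
      using f by (simp add: associate_space_def)
    finally have "?I / N g < \<infinity>" .
    show "?I < \<infinity>"
    proof (cases "N g = 0")
      case True
      then show ?thesis
        using nn_integral_mult_eq_0_if_norm_eq_0[OF assms(2)] g by (simp add: function_space_def)
    next
      case False
      \<comment> \<open>Since \<open>N g\<close> is finite, an infinite integral would make the
        quotient infinite. Finiteness of \<open>N g\<close> matters here, because in
        \<open>ennreal\<close> infinity divided by infinity is 0.\<close>
      with \<open>?I / N g < \<infinity>\<close> g show ?thesis
        by (cases "?I = \<infinity>") (auto simp: function_space_def ennreal_top_divide less_top split: if_splits)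
    qed
  qed
next
  assume "\<forall>g\<in>function_space \<mu> N. (\<integral>\<^sup>+x. modulus (f x * g x) \<partial>\<mu>) < \<infinity>"
  then show "f \<in> associate_space \<mu> N"
    using associate_functional_finite[OF assms(2,3)] assms(3) by (simp add: associate_space_def)
qed

end
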